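(* Let $K$ be an even integer, let $m,n\ge2$ be integers and $L=\mathrm{lcm}[m,n]$. Then: (a) if $\omega_K(m)=\omega_K(n)=t$ for some $t\in\{1,2,4\}$, then $\omega_K(L)=t$; (b) if one of $\omega_K(m),\omega_K(n)$ equals $2$ and the other equals $4$, then $\omega_K(L)=2$; (c) if one of $\omega_K(m),\omega_K(n)$ equals $1$ and the other equals $2$ or $4$, then $\omega_K(L)\in\{1,2\}$.
   Context: For an integer $K$, the $K$-Fibonacci sequence is $F_{K,0}=0$, $F_{K,1}=1$, $F_{K,n}=KF_{K,n-1}+F_{K,n-2}$ for $n\ge2$. For an integer $m\ge 2$, $\pi_K(m)$ is the least positive period of $(F_{K,n}\bmod m)$ and $\omega_K(m)$ is the number of indices $0\le j<\pi_K(m)$ with $m\mid F_{K,j}$; it takes values in $\{1,2,4\}$. *)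

theory Defs
  imports "HOL-Number_Theory.Number_Theory"
begin

fun K_fib :: "int \<Rightarrow> nat \<Rightarrow> int" where
  "K_fib K 0 = 0"
| "K_fib K (Suc 0) = 1"
| "K_fib K (Suc (Suc n)) = K * K_fib K (Suc n) + K_fib K n"

(* The recurrence is invertible modulo m, so for m > 0 the sequence is purely periodic
   modulo m: a positive period, valid from index 0 on, exists and LEAST is meaningful. *)
definition K_period :: "int \<Rightarrow> int \<Rightarrow> nat" where
  "K_period K m = (LEAST p. 0 < p \<and> (\<forall>i. [K_fib K (i + p) = K_fib K i] (mod m)))"

definition K_omega :: "int \<Rightarrow> int \<Rightarrow> nat" where
  "K_omega K m = card {j. j < K_period K m \<and> m dvd K_fib K j}"

end

(* Let a(m) be the least positive index of a term divisible by m. The zeros of the sequence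
   modulo m are the multiples of a(m) and the periods are the multiples of the least period p(m),
   so p(m) = a(m) omega(m), and both a and p turn lcm into lcm. Since
   F(2a + 1) = F(a + 1)^2 = (-1)^a modulo m for a = a(m), the number 2a is a period if a is even;
   for K even the converse holds as well (for m = 2 because F(j) and j have the same parity).
   Hence omega(m) = 4 only for a(m) odd and omega(m) = 1, 2 only for a(m) even, and the claims
   become statements about lcm(p(m), p(n)) / lcm(a(m), a(n)). *)

theory Submission
  imports Defs
begin

text \<open>Shifting by an element of \<open>P\<close> preserves membership, so \<open>P j\<close>
  depends only on j modulo the least positive element, and a nonzero residue in \<open>P\<close>
  would contradict minimality. Serves both the periods and the zeros modulo m.\<close>

lemma dvd_iff_Least_dvd:
  fixes P :: "nat \<Rightarrow> bool"
  assumes "0 < q" and "P q" and shift: "\<And>a b. P b \<Longrightarrow> P (a + b) \<longleftrightarrow> P a"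
  shows "P j \<longleftrightarrow> (LEAST p. 0 < p \<and> P p) dvd j"
proof -
  define p where "p = (LEAST p. 0 < p \<and> P p)"
  have p: "0 < p" "P p"
    using LeastI[of "\<lambda>p. 0 < p \<and> P p" q] assms(1,2) unfolding p_def by auto
  have zero: "P 0" using shift[of q 0] assms(2) by simp
  have mult: "P (r + p * k) \<longleftrightarrow> P r" for r k
  proof (induction k)
    case (Suc k)
    have "P (r + p * Suc k) \<longleftrightarrow> P ((r + p * k) + p)" by (simp add: algebra_simps)
    with Suc shift[OF p(2)] show ?case by blast
  qed simp
  have "P j \<longleftrightarrow> P (j mod p)" using mult[of "j mod p" "j div p"] by simp
  also have "\<dots> \<longleftrightarrow> j mod p = 0"
  proof
    assume "P (j mod p)"
    show "j mod p = 0"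
    proof (rule ccontr)
      assume "j mod p \<noteq> 0"
      with \<open>P (j mod p)\<close> have "p \<le> j mod p"
        unfolding p_def by (intro Least_le) auto
      with p(1) show False using mod_less_divisor[of p j] by linarith
    qed
  qed (simp add: zero)
  finally show ?thesis unfolding p_def by (simp add: dvd_eq_mod_eq_0)
qed

section \<open>Identities, parity and coprimality of the terms\<close>

lemma K_fib_add:
  "K_fib K (a + b) = K_fib K a * K_fib K (Suc b) + (K_fib K (Suc a) - K * K_fib K a) * K_fib K b"
  \<comment> \<open>The factor \<open>K_fib K (Suc a) - K * K_fib K a\<close> plays the part of the
    term of index a - 1; it covers a = 0 as well, with the value 1.\<close>
  by (induction K b rule: K_fib.induct) (simp_all add: algebra_simps)

text \<open>The form x^2 - K x y - y^2 in two consecutive terms changes sign with each step of the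
  recurrence.\<close>

lemma K_fib_cassini:
  "K_fib K (Suc n) ^ 2 - K * K_fib K (Suc n) * K_fib K n - K_fib K n ^ 2 = (-1) ^ n"
proof (induction n)
  case (Suc n)
  have "K_fib K (Suc (Suc n)) ^ 2 - K * K_fib K (Suc (Suc n)) * K_fib K (Suc n) - K_fib K (Suc n) ^ 2
    = - (K_fib K (Suc n) ^ 2 - K * K_fib K (Suc n) * K_fib K n - K_fib K n ^ 2)"
    by (simp add: power2_eq_square algebra_simps)
  with Suc show ?case by simp
qed simp

lemma even_K_fib_iff: "even K \<Longrightarrow> even (K_fib K n) \<longleftrightarrow> even n"
  by (induction K n rule: K_fib.induct) auto

lemma coprime_K_fib_Suc: "coprime (K_fib K n) (K_fib K (Suc n))"
proof (induction n)
  case (Suc n)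
  have "gcd (K_fib K (Suc n)) (K * K_fib K (Suc n) + K_fib K n) = gcd (K_fib K (Suc n)) (K_fib K n)"
    by (metis add.commute gcd_add_mult mult.commute)
  with Suc show ?case by (simp add: coprime_iff_gcd_eq_1 gcd.commute)
qed simp

text \<open>Modulo m the addition formula leaves only F(a) F(b + 1), and F(b + 1) is a unit because
  it is coprime to F(b).\<close>

lemma dvd_K_fib_add_iff:
  assumes "m dvd K_fib K b"
  shows "m dvd K_fib K (a + b) \<longleftrightarrow> m dvd K_fib K a"
proof -
  have "coprime m (K_fib K (Suc b))"
    using coprime_divisors[OF assms dvd_refl coprime_K_fib_Suc] .
  moreover have "m dvd K_fib K (a + b) \<longleftrightarrow> m dvd K_fib K a * K_fib K (Suc b)"
    unfolding K_fib_add using assms by (simp add: dvd_add_left_iff)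
  ultimately show ?thesis by (simp add: coprime_dvd_mult_left_iff)
qed

section \<open>Periods modulo m\<close>

definition K_periodic :: "int \<Rightarrow> int \<Rightarrow> nat \<Rightarrow> bool" where
  "K_periodic K m p \<longleftrightarrow> (\<forall>i. [K_fib K (i + p) = K_fib K i] (mod m))"

lemma K_periodic_iff:
  "K_periodic K m p \<longleftrightarrow> m dvd K_fib K p \<and> [K_fib K (Suc p) = 1] (mod m)"
proof
  assume "K_periodic K m p"
  then have "[K_fib K (0 + p) = K_fib K 0] (mod m)" "[K_fib K (1 + p) = K_fib K 1] (mod m)"
    unfolding K_periodic_def by blast+
  then show "m dvd K_fib K p \<and> [K_fib K (Suc p) = 1] (mod m)" by (simp add: cong_0_iff)
next
  assume *: "m dvd K_fib K p \<and> [K_fib K (Suc p) = 1] (mod m)"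
  have "[K_fib K (i + p) = K_fib K i] (mod m)" for i
  proof -
    have "[K_fib K i * K_fib K (Suc p) + (K_fib K (Suc i) - K * K_fib K i) * K_fib K p
        = K_fib K i * 1 + (K_fib K (Suc i) - K * K_fib K i) * 0] (mod m)"
      using * by (intro cong_add cong_mult) (auto simp: cong_0_iff)
    then show ?thesis by (simp add: K_fib_add)
  qed
  then show "K_periodic K m p" unfolding K_periodic_def by blast
qed

text \<open>The recurrence can be run backwards, F(i) = F(i + 2) - K F(i + 1), so a repeated pair of
  neighbours descends to the index 0.\<close>

lemma K_periodic_backwards:
  assumes "[K_fib K (i + p) = K_fib K i] (mod m)"
    and "[K_fib K (Suc (i + p)) = K_fib K (Suc i)] (mod m)"
  shows "K_periodic K m p"
  using assms
proof (induction i)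
  case 0
  then show ?case by (simp add: K_periodic_iff cong_0_iff)
next
  case (Suc i)
  have "[K_fib K (Suc (Suc (i + p))) - K * K_fib K (Suc (i + p))
      = K_fib K (Suc (Suc i)) - K * K_fib K (Suc i)] (mod m)"
    using Suc.prems by (intro cong_diff cong_mult) auto
  then show ?case using Suc by simp
qed

text \<open>Pigeonhole principle: there are only m^2 pairs of residues for two consecutive
  terms.\<close>

lemma K_periodic_exists:
  assumes "m > 0"
  obtains p where "0 < p" "K_periodic K m p"
proof -
  let ?f = "\<lambda>i. (K_fib K i mod m, K_fib K (Suc i) mod m)"
  have "range ?f \<subseteq> {0..<m} \<times> {0..<m}" using assms by auto
  then have "finite (range ?f)" by (rule finite_subset) simp
  then have "\<not> inj ?f" using finite_imageD by blast
  then obtain i j where "i < j" "?f i = ?f j"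
    unfolding inj_def by (metis linorder_neqE_nat)
  then have "K_periodic K m (j - i)"
    by (intro K_periodic_backwards[of K i]) (auto simp: cong_def)
  with \<open>i < j\<close> show thesis by (intro that) auto
qed

lemma K_periodic_iff_dvd:
  assumes "m > 0"
  shows "K_periodic K m j \<longleftrightarrow> K_period K m dvd j"
proof -
  obtain q where q: "0 < q" "K_periodic K m q" using K_periodic_exists[OF assms] .
  have "K_periodic K m (a + b) \<longleftrightarrow> K_periodic K m a" if "K_periodic K m b" for a b
    using that unfolding K_periodic_def by (metis add.assoc cong_sym cong_trans)
  from dvd_iff_Least_dvd[of q "K_periodic K m", OF q this] show ?thesis
    unfolding K_period_def K_periodic_def .
qed

section \<open>Zeros modulo m and their number in a period\<close>

text \<open>This is the rank of apparition (entry point) of m in the sequence.\<close>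

definition K_rank :: "int \<Rightarrow> int \<Rightarrow> nat" where
  "K_rank K m = (LEAST j. 0 < j \<and> m dvd K_fib K j)"

lemma dvd_K_fib_iff_K_rank_dvd:
  assumes "m > 0"
  shows "m dvd K_fib K j \<longleftrightarrow> K_rank K m dvd j"
proof -
  \<comment> \<open>A positive period is also the index of a zero, since F(0) = 0.\<close>
  obtain q where "0 < q" "K_periodic K m q" using K_periodic_exists[OF assms] .
  then show ?thesis unfolding K_rank_def
    by (intro dvd_iff_Least_dvd[of q] dvd_K_fib_add_iff) (auto simp: K_periodic_iff)
qed

lemma K_period_pos: "m > 0 \<Longrightarrow> K_period K m > 0"
  by (metis K_periodic_exists K_periodic_iff_dvd dvd_0_left_iff gr0I less_irrefl)

lemma K_rank_dvd_K_period: "m > 0 \<Longrightarrow> K_rank K m dvd K_period K m"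
  by (metis K_periodic_iff K_periodic_iff_dvd dvd_K_fib_iff_K_rank_dvd dvd_refl)

lemma K_rank_pos: "m > 0 \<Longrightarrow> K_rank K m > 0"
  using K_rank_dvd_K_period[of m K] K_period_pos[of m K] by (auto intro: gr0I)

text \<open>The zeros below the period are the multiples of the rank, one for each i below the
  quotient k.\<close>

lemma K_period_eq:
  assumes "m > 0"
  shows "K_period K m = K_rank K m * K_omega K m"
proof -
  let ?a = "K_rank K m"
  obtain k where k: "K_period K m = ?a * k" using K_rank_dvd_K_period[OF assms] unfolding dvd_def by blast
  have "{j. j < K_period K m \<and> m dvd K_fib K j} = (\<lambda>i. ?a * i) ` {..<k}"
    using K_rank_pos[OF assms, of K] by (auto simp: dvd_K_fib_iff_K_rank_dvd[OF assms] k)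
  moreover have "inj_on (\<lambda>i. ?a * i) {..<k}"
    using K_rank_pos[OF assms, of K] by (auto simp: inj_on_def)
  ultimately have "K_omega K m = k" unfolding K_omega_def by (simp add: card_image)
  with k show ?thesis by simp
qed

text \<open>A congruence modulo the lcm is a congruence modulo both numbers, so the periods modulo
  the lcm are the common multiples of the two least periods.\<close>

lemma K_period_lcm:
  assumes "m > 0" "n > 0"
  shows "K_period K (lcm m n) = lcm (K_period K m) (K_period K n)"
proof (rule dvd_antisym)
  have L: "lcm m n > 0" using assms by (simp add: lcm_pos_int)
  have "K_periodic K (lcm m n) p \<longleftrightarrow> K_periodic K m p \<and> K_periodic K n p" for p
    unfolding K_periodic_def by (auto simp: cong_iff_dvd_diff)
  then have *: "K_period K (lcm m n) dvd p \<longleftrightarrow> K_period K m dvd p \<and> K_period K n dvd p" for p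
    using assms L by (simp add: K_periodic_iff_dvd)
  show "K_period K (lcm m n) dvd lcm (K_period K m) (K_period K n)" unfolding * by simp
  show "lcm (K_period K m) (K_period K n) dvd K_period K (lcm m n)"
    using *[of "K_period K (lcm m n)"] by simp
qed

lemma K_rank_lcm:
  assumes "m > 0" "n > 0"
  shows "K_rank K (lcm m n) = lcm (K_rank K m) (K_rank K n)"
proof (rule dvd_antisym)
  have L: "lcm m n > 0" using assms by (simp add: lcm_pos_int)
  have *: "K_rank K (lcm m n) dvd p \<longleftrightarrow> K_rank K m dvd p \<and> K_rank K n dvd p" for p
    using assms L by (simp flip: dvd_K_fib_iff_K_rank_dvd)
  show "K_rank K (lcm m n) dvd lcm (K_rank K m) (K_rank K n)" unfolding * by simp
  show "lcm (K_rank K m) (K_rank K n) dvd K_rank K (lcm m n)"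
    using *[of "K_rank K (lcm m n)"] by simp
qed

lemma K_omega_dvd_2_iff:
  assumes "even K" "m \<ge> 2"
  shows "K_omega K m dvd 2 \<longleftrightarrow> even (K_rank K m)"
proof -
  define a where "a = K_rank K m"
  have m: "m > 0" using assms by simp
  have a: "m dvd K_fib K a" using m by (simp add: dvd_K_fib_iff_K_rank_dvd a_def)
  have "K_fib K (Suc (2 * a)) = K_fib K (Suc a) ^ 2 + K_fib K a ^ 2"
    using K_fib_add[of K "Suc a" a] unfolding mult_2 by (simp add: power2_eq_square algebra_simps)
  \<comment> \<open>Cassini's identity trades F(a + 1)^2 for the sign (-1)^a, up to a multiple of
    F(a).\<close>
  also have "\<dots> = (-1) ^ a + K_fib K a * (K * K_fib K (Suc a) + 2 * K_fib K a)"
    unfolding K_fib_cassini[of K a, symmetric] by (simp add: power2_eq_square algebra_simps)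
  finally have "m dvd K_fib K (Suc (2 * a)) - (-1) ^ a" using a by simp
  then have s: "[K_fib K (Suc (2 * a)) = (-1) ^ a] (mod m)" by (simp add: cong_iff_dvd_diff)
  \<comment> \<open>The positive rank cancels from a omega(m) dividing 2a.\<close>
  have "K_omega K m dvd 2 \<longleftrightarrow> K_period K m dvd 2 * a"
    using K_rank_pos[OF m, of K] by (simp add: K_period_eq[OF m] a_def mult.commute)
  also have "\<dots> \<longleftrightarrow> [K_fib K (Suc (2 * a)) = 1] (mod m)"
    using m by (simp add: K_periodic_iff flip: K_periodic_iff_dvd)
      (simp add: dvd_K_fib_iff_K_rank_dvd a_def)
  also have "\<dots> \<longleftrightarrow> [(-1) ^ a = 1] (mod m)"
    using s by (meson cong_sym cong_trans)
  also have "\<dots> \<longleftrightarrow> even a"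
  proof
    assume *: "[(-1) ^ a = 1] (mod m)"
    show "even a"
    proof (rule ccontr)
      assume "odd a"
      with * have "m dvd 2" by (simp add: cong_iff_dvd_diff)
      \<comment> \<open>Signs do not distinguish 1 from -1 modulo 2; here the parity of F(a) for
        even K decides instead.\<close>
      with assms have "m = 2" using zdvd_imp_le by fastforce
      with a \<open>odd a\<close> show False using even_K_fib_iff[OF \<open>even K\<close>] by simp
    qed
  qed simp
  finally show ?thesis by (simp add: a_def)
qed

section \<open>Doubling inside an lcm, and the three cases\<close>

lemma lcm_double_odd:
  fixes b c :: nat
  assumes "odd c"
  shows "lcm (2 * b) c = 2 * lcm b c"
proof -
  have "gcd (2 * b) c = gcd b c" using assms by (simp add: gcd_mult_left_left_cancel)
  then show ?thesis using div_mult_swap[of "gcd b c" "b * c" 2] by (simp add: lcm_nat_def mult.assoc)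
qed

text \<open>The larger lcm is a multiple of \<open>lcm b c\<close> and divides its double, so the
  quotient divides 2.\<close>

lemma lcm_double_right_cases:
  fixes b c :: nat
  shows "lcm b (2 * c) = lcm b c \<or> lcm b (2 * c) = 2 * lcm b c"
proof -
  have "lcm b c dvd lcm b (2 * c)" by (simp add: dvd_lcmI2)
  then obtain k where k: "lcm b (2 * c) = lcm b c * k" by (elim dvdE)
  have "lcm b (2 * c) dvd lcm b c * 2"
    using mult_dvd_mono[OF dvd_lcm2[of c b] dvd_refl[of 2]]
    by (intro lcm_least) (simp_all add: mult.commute)
  \<comment> \<open>If the lcm is 0, the quotient k is undetermined, but both sides of the claim
    vanish.\<close>
  then have "lcm b c = 0 \<or> k dvd 2" unfolding k by simp
  then have "lcm b c = 0 \<or> k = 1 \<or> k = 2" using prime_nat_iff two_is_prime_nat by blast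
  then show ?thesis using k by auto
qed

text \<open>Both sides are the period modulo \<open>lcm m n\<close>. The lcm of the ranks is
  positive, so omega of the lcm can be solved for.\<close>

lemma K_omega_lcm_mult:
  assumes "m > 0" "n > 0"
  shows "lcm (K_rank K m) (K_rank K n) * K_omega K (lcm m n)
    = lcm (K_rank K m * K_omega K m) (K_rank K n * K_omega K n)"
proof -
  have "lcm m n > 0" using assms by (simp add: lcm_pos_int)
  then show ?thesis using K_period_lcm[OF assms, of K]
    by (simp add: K_period_eq K_rank_lcm assms)
qed

lemma K_omega_lcm_same:
  assumes "m > 0" "n > 0" "K_omega K m = K_omega K n"
  shows "K_omega K (lcm m n) = K_omega K n"
proof -
  have "K_rank K m > 0" "K_rank K n > 0"
    using K_rank_pos assms by simp_all
  moreover have "lcm (K_rank K m) (K_rank K n) * K_omega K (lcm m n)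
      = lcm (K_rank K m) (K_rank K n) * K_omega K n"
    using K_omega_lcm_mult[OF assms(1,2), of K] assms(3)
    by (simp add: lcm_mult_right lcm.commute)
  ultimately show ?thesis by simp
qed

lemma K_omega_lcm_2_4:
  assumes "even K" "m \<ge> 2" "n \<ge> 2" "K_omega K m = 2" "K_omega K n = 4"
  shows "K_omega K (lcm m n) = 2"
proof -
  have even: "even (K_rank K m)" and odd: "odd (K_rank K n)"
    using assms K_omega_dvd_2_iff[of K m] K_omega_dvd_2_iff[of K n] by simp_all
  obtain b where b: "K_rank K m = 2 * b" using even by (elim evenE)
  define c where "c = K_rank K n"
  \<comment> \<open>Both periods carry a factor 4: the first is 2b times 2, the second c times
    4.\<close>
  have "lcm (2 * b) c * K_omega K (lcm m n) = lcm (4 * b) (4 * c)"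
    using K_omega_lcm_mult[of m n K] assms by (simp add: b c_def mult.commute)
  also have "\<dots> = 4 * lcm b c" by (simp add: lcm_mult_left)
  also have "\<dots> = lcm (2 * b) c * 2" using odd by (simp add: lcm_double_odd c_def)
  finally have "lcm (2 * b) c * K_omega K (lcm m n) = lcm (2 * b) c * 2" .
  moreover have "b > 0" "c > 0"
    using K_rank_pos[of m K] K_rank_pos[of n K] assms by (simp_all add: b c_def)
  ultimately show ?thesis by simp
qed

lemma K_omega_lcm_1:
  assumes "even K" "m \<ge> 2" "n \<ge> 2" "K_omega K m = 1" "K_omega K n \<in> {2, 4}"
  shows "K_omega K (lcm m n) \<in> {1, 2}"
proof -
  define a c l w where "a = K_rank K m" "c = K_rank K n" "l = lcm a c" "w = K_omega K (lcm m n)"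
  note defs = this
  have l: "l > 0"
    using K_rank_pos[of m K] K_rank_pos[of n K] assms by (simp add: lcm_pos_nat defs)
  have mult: "l * w = lcm a (c * K_omega K n)"
    using K_omega_lcm_mult[of m n K] assms(2-4) by (simp add: defs)
  have "l * w = l \<or> l * w = l * 2"
  proof (cases "K_omega K n = 2")
    case True
    then show ?thesis
      using mult lcm_double_right_cases[of a c] by (simp add: defs(3) mult.commute)
  next
    case False
    with assms have n: "K_omega K n = 4" by simp
    have "even a" "odd c"
      using assms n K_omega_dvd_2_iff[of K m] K_omega_dvd_2_iff[of K n] by (simp_all add: defs)
    obtain b where b: "a = 2 * b" using \<open>even a\<close> by (elim evenE)
    \<comment> \<open>One factor 2 of 4c comes out together with that of a = 2b. As l also equals 2
      \<open>lcm b c\<close>, only a single doubling of c remains to be compared.\<close>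
    have "l * w = lcm (2 * b) (2 * (2 * c))" using mult n b by (simp add: mult.commute)
    also have "\<dots> = 2 * lcm b (2 * c)" by (simp only: lcm_mult_left normalize_nat_def id_apply)
    finally have "l * w = 2 * lcm b (2 * c)" .
    moreover have "l = 2 * lcm b c" using \<open>odd c\<close> by (simp add: defs(3) b lcm_double_odd)
    ultimately show ?thesis using lcm_double_right_cases[of b c] by auto
  qed
  with l have "w = 1 \<or> w = 2" by auto
  then show ?thesis by (simp add: defs(4))
qed

theorem theorem4p30:
  fixes K m n L :: int
  assumes "even K" and "m \<ge> 2" and "n \<ge> 2" and "L = lcm m n"
  shows "(\<forall>t \<in> {1, 2, 4}. K_omega K m = t \<and> K_omega K n = t \<longrightarrow> K_omega K L = t)
    \<and> ((K_omega K m = 2 \<and> K_omega K n = 4) \<or> (K_omega K m = 4 \<and> K_omega K n = 2)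
         \<longrightarrow> K_omega K L = 2)
    \<and> ((K_omega K m = 1 \<and> K_omega K n \<in> {2, 4}) \<or> (K_omega K m \<in> {2, 4} \<and> K_omega K n = 1)
         \<longrightarrow> K_omega K L \<in> {1, 2})"
proof (intro conjI ballI impI)
  fix t
  assume "K_omega K m = t \<and> K_omega K n = t"
  then show "K_omega K L = t" using K_omega_lcm_same[of m n K] assms by simp
next
  assume "(K_omega K m = 2 \<and> K_omega K n = 4) \<or> (K_omega K m = 4 \<and> K_omega K n = 2)"
  then show "K_omega K L = 2"
    using K_omega_lcm_2_4[of K m n] K_omega_lcm_2_4[of K n m] assms by (auto simp: lcm.commute)
next
  assume "(K_omega K m = 1 \<and> K_omega K n \<in> {2, 4}) \<or> (K_omega K m \<in> {2, 4} \<and> K_omega K n = 1)"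
  then show "K_omega K L \<in> {1, 2}"
    using K_omega_lcm_1[of K m n] K_omega_lcm_1[of K n m] assms by (metis lcm.commute)
qed

end
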